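(* If $\ell,k$ are integers with $0\le \ell<k$ and $k\ge 4$, then there is a coprime mapping from $A=\{\ell+1,\dots,\ell+k\}$ to $B=\{\ell+k+1,\dots,\ell+2k\}$.
   Context: For sets of integers $A,B$, a bijection $g:A\to B$ is a coprime mapping if $a$ and $g(a)$ are coprime for every $a\in A$. *)

theory Defs
  imports Main
begin

definition coprime_mapping :: "(int \<Rightarrow> int) \<Rightarrow> int set \<Rightarrow> int set \<Rightarrow> bool" where
  "coprime_mapping g A B \<longleftrightarrow> bij_betw g A B \<and> (\<forall>a\<in>A. coprime a (g a))"

end

theory Submission
  imports Defs Complex_Main "HOL-Number_Theory.Cong"
begin

text \<open>
Evens of either interval must be matched with odds of the other, and each of these two tasks asks
for a coprime matching between two progressions with step 2 and \<open>m\<close> terms, all at most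
\<open>6 m + 2\<close>. If Hall's condition fails, there are sets \<open>S\<close> and \<open>T\<close> of terms of the two progressions
with \<open>|S| + |T| = m + 1\<close>, say \<open>|S| \<le> |T|\<close>, without a coprime pair. Hence every member of \<open>S\<close> has fewer
than \<open>|S|\<close> coprime partners, while sieving shows that \<open>x\<close> has about \<open>c(x) m\<close> of them, where
\<open>c(x)\<close> is the product of \<open>1 - 1/p\<close> over the odd primes \<open>p\<close> dividing \<open>x\<close>.

For large \<open>m\<close> the second moment decides: the mean of \<open>1/c(x)\<^sup>2\<close> over the whole progression is
at most an Euler product smaller than 2, whereas the members of \<open>S\<close> alone would contribute about
\<open>m/|S| \<ge> 2\<close>. For \<open>9 \<le> m < 100000\<close> the number of prime factors is so small that counting multiples
first forces 3 to divide all of \<open>S\<close>, hence \<open>|S| \<le> (m + 2)/3\<close>, and this is again too small. The remaining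
finitely many cases are decided by search.
\<close>

section \<open>Hall's marriage theorem\<close>

text \<open>Halmos-Vaughan induction: a tight proper subset splits the problem into two smaller
  ones; if there is none, any single edge can be fixed and its ends removed.\<close>

theorem hall_marriage:
  fixes N :: "'a \<Rightarrow> 'b set"
  assumes "finite X" and "\<And>x. x \<in> X \<Longrightarrow> finite (N x)"
    and "\<And>S. S \<subseteq> X \<Longrightarrow> card S \<le> card (\<Union>x\<in>S. N x)"
  shows "\<exists>f. inj_on f X \<and> (\<forall>x\<in>X. f x \<in> N x)"
  using assms
proof (induction X arbitrary: N rule: finite_psubset_induct)
  case (psubset X)
  note fin = psubset.prems(1) and hall = psubset.prems(2)
  show ?case
  proof (cases "\<exists>S. S \<subset> X \<and> S \<noteq> {} \<and> card (\<Union>x\<in>S. N x) = card S")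
    case True
    then obtain S where S: "S \<subset> X" "S \<noteq> {}" "card (\<Union>x\<in>S. N x) = card S" by blast
    define M where "M = (\<Union>x\<in>S. N x)"
    have finS: "finite S" using S psubset.hyps finite_subset by blast
    have finM: "finite M" unfolding M_def using finS S fin by auto
    have "\<exists>f. inj_on f S \<and> (\<forall>x\<in>S. f x \<in> N x)"
      by (rule psubset.IH[OF S(1)]) (use S fin hall in auto)
    then obtain f where f: "inj_on f S" "\<And>x. x \<in> S \<Longrightarrow> f x \<in> N x" by blast
    have "\<exists>g. inj_on g (X - S) \<and> (\<forall>x\<in>X - S. g x \<in> N x - M)"
    proof (rule psubset.IH)
      show "X - S \<subset> X" using S by blast
      show "finite (N x - M)" if "x \<in> X - S" for x using fin that by auto
      \<comment> \<open>Hall's condition for \<open>R \<union> S\<close>, minus the equality for the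
        tight set \<open>S\<close>, leaves what \<open>R\<close> needs outside
        \<open>M\<close>.\<close>
      fix R assume R: "R \<subseteq> X - S"
      then have finR: "finite R" using psubset.hyps finite_subset by blast
      have "card R + card S = card (R \<union> S)"
        using R finR finS by (subst card_Un_disjoint) auto
      also have "\<dots> \<le> card (\<Union>x\<in>R \<union> S. N x)" by (rule hall) (use R S in auto)
      also have "(\<Union>x\<in>R \<union> S. N x) = (\<Union>x\<in>R. N x - M) \<union> M" by (auto simp: M_def)
      also have "card \<dots> \<le> card (\<Union>x\<in>R. N x - M) + card M" by (rule card_Un_le)
      finally show "card R \<le> card (\<Union>x\<in>R. N x - M)" using S(3) by (simp add: M_def)
    qed
    then obtain g where g: "inj_on g (X - S)" "\<And>x. x \<in> X - S \<Longrightarrow> g x \<in> N x - M" by blast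
    let ?h = "\<lambda>x. if x \<in> S then f x else g x"
    have fM: "f x \<in> M" if "x \<in> S" for x using f(2) that by (auto simp: M_def)
    have "inj_on ?h X"
    proof (rule inj_onI)
      fix x y assume "x \<in> X" "y \<in> X" "?h x = ?h y"
      then show "x = y"
        using f(1) g fM by (cases "x \<in> S"; cases "y \<in> S") (force dest: inj_onD)+
    qed
    moreover have "\<forall>x\<in>X. ?h x \<in> N x" using f g by auto
    ultimately show ?thesis by blast
  next
    case False
    show ?thesis
    proof (cases "X = {}")
      case False': False
      then obtain x where x: "x \<in> X" by blast
      have "card {x} \<le> card (\<Union>z\<in>{x}. N z)" by (rule hall) (use x in auto)
      then have "N x \<noteq> {}" by auto
      then obtain y where y: "y \<in> N x" by blast
      have "\<exists>g. inj_on g (X - {x}) \<and> (\<forall>z\<in>X - {x}. g z \<in> N z - {y})"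
      proof (rule psubset.IH)
        show "X - {x} \<subset> X" using x by blast
        show "finite (N z - {y})" if "z \<in> X - {x}" for z using fin that by auto
        fix R assume R: "R \<subseteq> X - {x}"
        show "card R \<le> card (\<Union>z\<in>R. N z - {y})"
        proof (cases "R = {}")
          case nonempty: False
          \<comment> \<open>Being nonempty, proper and not tight, \<open>R\<close> has a neighbour
            to spare, so losing \<open>y\<close> does no harm.\<close>
          have "R \<subset> X" using R x by blast
          then have "card R \<noteq> card (\<Union>z\<in>R. N z)" using False nonempty by metis
          moreover have "card R \<le> card (\<Union>z\<in>R. N z)" by (rule hall) (use R in auto)
          moreover have "(\<Union>z\<in>R. N z - {y}) = (\<Union>z\<in>R. N z) - {y}" by auto
          ultimately show ?thesis by (auto simp: card_Diff_singleton_if)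
        qed auto
      qed
      then obtain g where g: "inj_on g (X - {x})" "\<And>z. z \<in> X - {x} \<Longrightarrow> g z \<in> N z - {y}"
        by blast
      have "inj_on (g(x := y)) X"
        using g by (auto simp: inj_on_def)
      moreover have "\<forall>z\<in>X. (g(x := y)) z \<in> N z" using g y by auto
      ultimately show ?thesis by blast
    qed auto
  qed
qed

section \<open>Backtracking search for small intervals\<close>

text \<open>The conditional keeps the evaluation from exploring the recursive call after a failed test.\<close>

primrec matchable :: "nat list \<Rightarrow> nat list \<Rightarrow> bool" where
  "matchable [] ys = True"
| "matchable (x # xs) ys =
     list_ex (\<lambda>y. if coprime x y then matchable xs (remove1 y ys) else False) ys"

lemma matchable_imp_injection:
  assumes "matchable xs ys" "distinct xs" "distinct ys"
  shows "\<exists>f. inj_on f (set xs) \<and> (\<forall>x\<in>set xs. f x \<in> set ys \<and> coprime x (f x))"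
  using assms
proof (induction xs arbitrary: ys)
  case (Cons x xs)
  then obtain y where y: "y \<in> set ys" "coprime x y" "matchable xs (remove1 y ys)"
    by (auto simp: list_ex_iff split: if_splits)
  then obtain f where f: "inj_on f (set xs)"
      "\<And>z. z \<in> set xs \<Longrightarrow> f z \<in> set (remove1 y ys) \<and> coprime z (f z)"
    using Cons.IH[of "remove1 y ys"] Cons.prems by (auto simp del: set_remove1_eq)
  have "inj_on (f(x := y)) (set (x # xs))"
    using f Cons.prems by (auto simp: inj_on_def)
  moreover have "\<forall>z\<in>set (x # xs). (f(x := y)) z \<in> set ys \<and> coprime z ((f(x := y)) z)"
    using f y Cons.prems by auto
  ultimately show ?case by blast
qed auto

text \<open>The order of the lists keeps the search short: the evens of the first interval come
  first and are offered the odds of the second. Both are equally numerous, so the odds treated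
  afterwards find only evens left.\<close>

lemma matchable_small:
  "\<forall>k\<in>set [4..<18]. \<forall>l\<in>set [0..<k]. matchable
     (filter even [l+1..<l+k+1] @ filter odd [l+1..<l+k+1])
     (filter odd [l+k+1..<l+2*k+1] @ filter even [l+k+1..<l+2*k+1])"
  by code_simp

section \<open>Sieving an arithmetic progression\<close>

text \<open>The step \<open>D\<close> varies because the terms divisible by a prime \<open>q\<close>
  form a progression with step \<open>D * q\<close>, on which the sieving is repeated.\<close>

definition sifted :: "nat \<Rightarrow> nat \<Rightarrow> nat \<Rightarrow> nat set \<Rightarrow> nat set" where
  "sifted D b n P = {i. i < n \<and> (\<forall>p\<in>P. \<not> p dvd b + D * i)}"

lemma finite_sifted [simp]: "finite (sifted D b n P)"
  by (simp add: sifted_def)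

lemma sifted_empty [simp]: "sifted D b n {} = {..<n}"
  by (auto simp: sifted_def)

lemma multiples_in_progression:
  fixes q D b n :: nat
  assumes "coprime q D" and "0 < q"
  obtains i0 n' where "q dvd b + D * i0"
    and "{i. i < n \<and> q dvd b + D * i} = (\<lambda>j. i0 + q * j) ` {..<n'}"
    and "q * n' \<le> n + q - 1" and "n \<le> q * n' + (q - 1)"
proof -
  obtain x where x: "[D * x = 1] (mod q)"
    using cong_solve_coprime_nat[of D q] assms by (auto simp: coprime_commute)
  \<comment> \<open>\<open>x\<close> inverts \<open>D\<close> modulo \<open>q\<close>, and
    \<open>(q - 1) * b\<close> stands for -b within the naturals, so \<open>i0\<close> is the least
    solution of D * i0 = -b modulo \<open>q\<close>.\<close>
  define i0 where "i0 = (x * ((q - 1) * b)) mod q"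
  \<comment> \<open>This is the ceiling of (n - i0) / q. Adding \<open>q - 1\<close> before
    subtracting \<open>i0 < q\<close> avoids truncation.\<close>
  define n' where "n' = (n + (q - 1) - i0) div q"
  have i0: "i0 < q" using assms by (simp add: i0_def)
  have "[D * i0 = D * (x * ((q - 1) * b))] (mod q)"
    unfolding i0_def by (intro cong_mult cong_refl) (simp add: cong_def)
  also have "D * (x * ((q - 1) * b)) = (D * x) * ((q - 1) * b)" by (simp add: ac_simps)
  also have "[\<dots> = 1 * ((q - 1) * b)] (mod q)" by (intro cong_mult x cong_refl)
  finally have "[b + D * i0 = b + 1 * ((q - 1) * b)] (mod q)" by (intro cong_add cong_refl)
  also have "b + 1 * ((q - 1) * b) = q * b"
    using assms by (cases q) auto
  also have "[\<dots> = 0] (mod q)" by (simp add: cong_def)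
  finally have dvd0: "q dvd b + D * i0" by (simp add: cong_0_iff)
  have iff: "q dvd b + D * i \<longleftrightarrow> [i = i0] (mod q)" for i
  proof -
    have "q dvd b + D * i \<longleftrightarrow> [b + D * i = b + D * i0] (mod q)"
      using dvd0 by (metis cong_0_iff cong_sym cong_trans)
    also have "\<dots> \<longleftrightarrow> [D * i = D * i0] (mod q)" by (simp add: cong_add_lcancel_nat)
    also have "\<dots> \<longleftrightarrow> [i = i0] (mod q)"
      using assms by (simp add: cong_mult_lcancel_nat coprime_commute)
    finally show ?thesis .
  qed
  have bound: "i0 + q * j < n \<longleftrightarrow> j < n'" for j
  proof -
    have "j < n' \<longleftrightarrow> Suc j \<le> n'" by auto
    also have "\<dots> \<longleftrightarrow> Suc j * q \<le> n + (q - 1) - i0"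
      unfolding n'_def using assms by (simp add: less_eq_div_iff_mult_less_eq)
    also have "\<dots> \<longleftrightarrow> i0 + q * j < n" using i0 by (auto simp: algebra_simps)
    finally show ?thesis by simp
  qed
  have set_eq: "{i. i < n \<and> q dvd b + D * i} = (\<lambda>j. i0 + q * j) ` {..<n'}"
  proof (intro set_eqI iffI)
    fix i assume i: "i \<in> {i. i < n \<and> q dvd b + D * i}"
    then have "i mod q = i0" using iff i0 by (auto simp: cong_def)
    then have "i = i0 + q * (i div q)" by (metis add.commute mult_div_mod_eq)
    then show "i \<in> (\<lambda>j. i0 + q * j) ` {..<n'}" using i bound[of "i div q"] by auto
  next
    fix i assume "i \<in> (\<lambda>j. i0 + q * j) ` {..<n'}"
    then show "i \<in> {i. i < n \<and> q dvd b + D * i}"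
      using bound iff by (auto simp: cong_def)
  qed
  have le1: "q * n' \<le> n + (q - 1) - i0"
    unfolding n'_def by simp
  have "n + (q - 1) - i0 < q * n' + q"
    unfolding n'_def using mult_div_mod_eq[of q "n + (q - 1) - i0"]
      mod_less_divisor[of q "n + (q - 1) - i0"] assms(2) by linarith
  then have "n \<le> q * n' + (q - 1)" using i0 by linarith
  moreover have "q * n' \<le> n + q - 1" using le1 assms by linarith
  ultimately show ?thesis using that dvd0 set_eq by blast
qed

lemma sifted_multiples:
  fixes q D b n :: nat
  assumes "coprime q D" and "0 < q"
  obtains b' n' where "q * n' \<le> n + q - 1" and "n \<le> q * n' + (q - 1)"
    and "\<And>P. card {i \<in> sifted D b n P. q dvd b + D * i} = card (sifted (D * q) b' n' P)"
proof -
  obtain i0 n' where *: "q dvd b + D * i0"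
    "{i. i < n \<and> q dvd b + D * i} = (\<lambda>j. i0 + q * j) ` {..<n'}"
    "q * n' \<le> n + q - 1" "n \<le> q * n' + (q - 1)"
    using multiples_in_progression[OF assms, of b n] by blast
  have "card {i \<in> sifted D b n P. q dvd b + D * i} = card (sifted (D * q) (b + D * i0) n' P)" for P
  proof -
    have "{i \<in> sifted D b n P. q dvd b + D * i} =
        {i \<in> {i. i < n \<and> q dvd b + D * i}. \<forall>p\<in>P. \<not> p dvd b + D * i}"
      by (auto simp: sifted_def)
    also have "\<dots> = (\<lambda>j. i0 + q * j) ` sifted (D * q) (b + D * i0) n' P"
      unfolding *(2) by (auto simp: sifted_def algebra_simps)
    finally show ?thesis
      using assms by (simp add: card_image inj_on_def)
  qed
  with *(3,4) that show ?thesis by blast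
qed

lemma card_multiples_le:
  fixes q D b n :: nat
  assumes "coprime q D" and "0 < q"
  shows "real (card {i. i < n \<and> q dvd b + D * i}) \<le> (real n + real q - 1) / real q"
proof -
  obtain b' n' where *: "q * n' \<le> n + q - 1" "n \<le> q * n' + (q - 1)"
    "\<And>P. card {i \<in> sifted D b n P. q dvd b + D * i} = card (sifted (D * q) b' n' P)"
    using sifted_multiples[OF assms, of n b] by blast
  have "real (q * n') \<le> real (n + q - 1)" using *(1) by linarith
  then have "real n' \<le> (real n + real q - 1) / real q"
    using assms by (simp add: le_divide_eq of_nat_diff mult.commute)
  moreover have "{i \<in> sifted D b n {}. q dvd b + D * i} = {i. i < n \<and> q dvd b + D * i}" by auto
  ultimately show ?thesis using *(3)[of "{}"] by simp
qed

text \<open>Of the n' multiples of \<open>q\<close>, at least (n' + 1) / p - 1 are divisible by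
  \<open>p\<close>; at most (1 - 1/p) (n' + 1) remain.\<close>

lemma card_multiples_sifted_le:
  fixes p q D b n :: nat
  assumes "coprime q D" "0 < q" "coprime p (D * q)" "0 < p"
  shows "real (card {i. i < n \<and> q dvd b + D * i \<and> \<not> p dvd b + D * i})
    \<le> (1 - 1 / real p) * ((real n + real q - 1) / real q + 1)"
proof -
  obtain b' n' where 1: "q * n' \<le> n + q - 1" "n \<le> q * n' + (q - 1)"
    "\<And>P. card {i \<in> sifted D b n P. q dvd b + D * i} = card (sifted (D * q) b' n' P)"
    using sifted_multiples[OF assms(1,2), of n b] by blast
  obtain b'' n'' where 2: "p * n'' \<le> n' + p - 1" "n' \<le> p * n'' + (p - 1)"
    "\<And>P. card {i \<in> sifted (D * q) b' n' P. p dvd b' + D * q * i} =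
      card (sifted (D * q * p) b'' n'' P)"
    using sifted_multiples[OF assms(3,4), of n' b'] by blast
  have "real (q * n') \<le> real (n + q - 1)" using 1(1) by linarith
  then have n': "real n' \<le> (real n + real q - 1) / real q"
    using assms by (simp add: le_divide_eq of_nat_diff mult.commute)
  have "real n' \<le> real (p * n'' + (p - 1))" using 2(2) by linarith
  also have "\<dots> = (real n'' + 1) * real p - 1"
    using assms by (simp add: of_nat_diff algebra_simps)
  finally have "(real n' + 1) / real p \<le> real n'' + 1"
    using assms by (simp add: divide_le_eq)
  then have n'': "(real n' + 1) / real p - 1 \<le> real n''" by linarith
  have "sifted (D * q) b' n' {p} = {..<n'} - {i \<in> sifted (D * q) b' n' {}. p dvd b' + D * q * i}"
    by (auto simp: sifted_def)
  then have "card (sifted (D * q) b' n' {p}) = n' - n''"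
    using 2(3)[of "{}"] by (subst \<open>sifted (D * q) b' n' {p} = _\<close>, subst card_Diff_subset) auto
  moreover have "n'' \<le> n'"
  proof -
    have "n'' = card {i \<in> {..<n'}. p dvd b' + D * q * i}" using 2(3)[of "{}"] by simp
    also have "\<dots> \<le> card {..<n'}" by (rule card_mono) auto
    finally show ?thesis by simp
  qed
  ultimately have "real (card (sifted (D * q) b' n' {p})) = real n' - real n''"
    by (simp add: of_nat_diff)
  also have "\<dots> \<le> (1 - 1 / real p) * (real n' + 1)"
  proof -
    have "(1 - 1 / real p) * (real n' + 1) = (real n' + 1) - (real n' + 1) / real p"
      by (simp add: left_diff_distrib)
    then show ?thesis using n'' by linarith
  qed
  also have "\<dots> \<le> (1 - 1 / real p) * ((real n + real q - 1) / real q + 1)"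
    using n' assms by (intro mult_left_mono) auto
  finally have bound: "real (card (sifted (D * q) b' n' {p}))
      \<le> (1 - 1 / real p) * ((real n + real q - 1) / real q + 1)" .
  have "{i. i < n \<and> q dvd b + D * i \<and> \<not> p dvd b + D * i} =
      {i \<in> sifted D b n {p}. q dvd b + D * i}" by (auto simp: sifted_def)
  then show ?thesis using bound 1(3)[of "{p}"] by (simp only:)
qed

text \<open>Legendre's sieve. Adding a prime \<open>q\<close> to \<open>P\<close> removes the sifted
  multiples of \<open>q\<close>, which form a sifted progression of length n / q up to an error of
  1. Hence the error grows from e to 2 e + 1, starting at 0.\<close>

lemma card_sifted_approx:
  assumes "finite P" "\<And>p. p \<in> P \<Longrightarrow> prime p \<and> coprime p D"
  shows "\<bar>real (card (sifted D b n P)) - real n * (\<Prod>p\<in>P. 1 - 1 / real p)\<bar> \<le> 2 ^ card P - 1"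
  using assms
proof (induction P arbitrary: D b n rule: finite_induct)
  case (insert q P)
  let ?c = "\<Prod>p\<in>P. 1 - 1 / real p"
  have q: "prime q" "coprime q D" using insert.prems by auto
  have q0: "0 < q" using q by (simp add: prime_gt_0_nat)
  obtain b' n' where *: "q * n' \<le> n + q - 1" "n \<le> q * n' + (q - 1)"
    "\<And>P. card {i \<in> sifted D b n P. q dvd b + D * i} = card (sifted (D * q) b' n' P)"
    using sifted_multiples[OF q(2) q0, of n b] by blast
  have le: "card {i \<in> sifted D b n P. q dvd b + D * i} \<le> card (sifted D b n P)"
    by (rule card_mono) auto
  have "sifted D b n (insert q P) = sifted D b n P - {i \<in> sifted D b n P. q dvd b + D * i}"
    by (auto simp: sifted_def)
  then have card_eq: "real (card (sifted D b n (insert q P))) =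
      real (card (sifted D b n P)) - real (card (sifted (D * q) b' n' P))"
    using *(3) le by (simp add: card_Diff_subset of_nat_diff)
  have c: "0 \<le> ?c" "?c \<le> 1"
    using insert.prems by (auto intro!: prod_nonneg prod_le_1 simp: prime_gt_0_nat Suc_leI)
  have IH1: "\<bar>real (card (sifted D b n P)) - real n * ?c\<bar> \<le> 2 ^ card P - 1"
    using insert by auto
  have "coprime p (D * q)" if "p \<in> P" for p
    using that insert.prems insert.hyps q by (auto intro!: primes_coprime)
  then have IH2: "\<bar>real (card (sifted (D * q) b' n' P)) - real n' * ?c\<bar> \<le> 2 ^ card P - 1"
    using insert.IH[of "D * q" b' n'] insert.prems by auto
  have "real (q * n') \<le> real (n + q - 1)" "real n \<le> real (q * n' + (q - 1))"
    using * by linarith+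
  then have "\<bar>real n' - real n / real q\<bar> \<le> 1"
    using q0 by (auto simp: abs_le_iff field_simps of_nat_diff)
  then have "\<bar>real n' - real n / real q\<bar> * \<bar>?c\<bar> \<le> 1 * 1"
    using c by (intro mult_mono) auto
  then have n': "\<bar>real n' * ?c - real n / real q * ?c\<bar> \<le> 1"
    by (simp add: abs_mult[symmetric] algebra_simps)
  have "real n * (\<Prod>p\<in>insert q P. 1 - 1 / real p) = real n * ?c - real n / real q * ?c"
    using insert.hyps by (simp add: algebra_simps)
  moreover have "(2::real) ^ card (insert q P) - 1 = (2 ^ card P - 1) + (2 ^ card P - 1) + 1"
    using insert.hyps by simp
  moreover have "\<bar>A - B - (x - z)\<bar> \<le> e + e + 1"
    if "\<bar>A - x\<bar> \<le> e" "\<bar>B - y\<bar> \<le> e" "\<bar>y - z\<bar> \<le> 1" for A B x y z e :: real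
    using that by linarith
  ultimately show ?case
    using IH1 IH2 n' card_eq by presburger
qed auto

section \<open>Odd prime divisors\<close>

definition odd_primes :: "nat \<Rightarrow> nat set" where
  "odd_primes x = {p. prime p \<and> odd p \<and> p dvd x}"

lemma finite_odd_primes: "0 < x \<Longrightarrow> finite (odd_primes x)"
  by (rule finite_subset[of _ "{..x}"]) (auto simp: odd_primes_def dest: dvd_imp_le)

lemma odd_primes_ge_3: "p \<in> odd_primes x \<Longrightarrow> 3 \<le> p"
  using prime_ge_2_nat[of p] by (cases "p = 2") (auto simp: odd_primes_def)

lemma odd_primes_coprime_2: "p \<in> odd_primes x \<Longrightarrow> coprime p 2"
  by (auto simp: odd_primes_def coprime_right_2_iff_odd)

text \<open>Numbers with an odd sum cannot share the prime 2; this is why only odd primes are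
  collected.\<close>

lemma coprime_iff_odd_primes:
  assumes "odd (x + y)"
  shows "coprime x y \<longleftrightarrow> (\<forall>p\<in>odd_primes x. \<not> p dvd y)"
proof
  assume "coprime x y"
  then show "\<forall>p\<in>odd_primes x. \<not> p dvd y"
    using not_prime_unit by (auto simp: odd_primes_def dest: coprime_common_divisor)
next
  assume *: "\<forall>p\<in>odd_primes x. \<not> p dvd y"
  show "coprime x y"
  proof (rule ccontr)
    assume "\<not> coprime x y"
    then have "gcd x y \<noteq> 1" by (simp add: coprime_iff_gcd_eq_1)
    then obtain p where "prime p" "p dvd gcd x y" using prime_factor_nat by blast
    then have p: "prime p" "p dvd x" "p dvd y" by auto
    have "odd p" using p assms by (auto dest: dvd_trans)
    with p * show False by (auto simp: odd_primes_def)
  qed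
qed

lemma prod_primes_dvd_of_all_dvd:
  fixes P :: "nat set"
  assumes "finite P" "\<And>p. p \<in> P \<Longrightarrow> prime p \<and> p dvd x"
  shows "\<Prod>P dvd x"
  using assms
proof (induction P rule: finite_induct)
  case (insert q P)
  have "coprime q (\<Prod>P)"
    using insert by (intro prod_coprime_right primes_coprime) auto
  then show ?case using insert by (auto intro: divides_mult)
qed auto

lemma Max_odd_ge:
  fixes P :: "nat set"
  assumes "finite P" "P \<noteq> {}" "\<And>p. p \<in> P \<Longrightarrow> odd p \<and> c \<le> p" "odd c"
  shows "c + 2 * (card P - 1) \<le> Max P"
proof -
  have "P \<subseteq> (\<lambda>i. c + 2 * i) ` {..(Max P - c) div 2}"
  proof
    fix p assume p: "p \<in> P"
    then have "even (p - c)" "c \<le> p" "p \<le> Max P" using assms by auto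
    then have "p = c + 2 * ((p - c) div 2)" "(p - c) div 2 \<le> (Max P - c) div 2"
      by (auto intro: div_le_mono)
    then show "p \<in> (\<lambda>i. c + 2 * i) ` {..(Max P - c) div 2}" by blast
  qed
  then have "card P \<le> card ((\<lambda>i. c + 2 * i) ` {..(Max P - c) div 2})"
    by (intro card_mono) auto
  also have "\<dots> \<le> card {..(Max P - c) div 2}" by (intro card_image_le) auto
  finally have "card P - 1 \<le> (Max P - c) div 2" by simp
  moreover have "c \<le> Max P" using assms Max_in by blast
  ultimately show ?thesis by linarith
qed

text \<open>Primes will be compared with the consecutive odd numbers c, c + 2, ..., which requires
  no list of primes. The induction removes \<open>Max P\<close>, which by \<open>Max_odd_ge\<close>
  is at least the last of these numbers.\<close>

lemma sum_odd_le:
  fixes P :: "nat set" and f :: "nat \<Rightarrow> real"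
  assumes "finite P" "\<And>p. p \<in> P \<Longrightarrow> odd p \<and> c \<le> p" "odd c"
    and "\<And>p q. c \<le> p \<Longrightarrow> p \<le> q \<Longrightarrow> f q \<le> f p"
  shows "sum f P \<le> (\<Sum>i<card P. f (c + 2 * i))"
  using assms(1,2)
proof (induction "card P" arbitrary: P)
  case (Suc w)
  have ne: "P \<noteq> {}" using Suc.hyps(2) by auto
  have M: "Max P \<in> P" "c + 2 * w \<le> Max P"
    using Max_in[of P] ne Suc.prems Suc.hyps(2) Max_odd_ge[of P c] assms(3) by auto
  have w: "w = card (P - {Max P})" using Suc.hyps(2) Suc.prems(1) M(1) by simp
  have "sum f P = f (Max P) + sum f (P - {Max P})" using Suc.prems M by (simp add: sum.remove)
  also have "sum f (P - {Max P}) \<le> (\<Sum>i<w. f (c + 2 * i))"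
    using Suc.hyps(1)[OF w] Suc.prems w by auto
  also have "f (Max P) \<le> f (c + 2 * w)" using M assms(4) by simp
  finally show ?case using Suc.hyps(2)[symmetric] by simp
qed auto

lemma prod_odd_ge:
  fixes P :: "nat set" and f :: "nat \<Rightarrow> real"
  assumes "finite P" "\<And>p. p \<in> P \<Longrightarrow> odd p \<and> c \<le> p" "odd c"
    and "\<And>p q. c \<le> p \<Longrightarrow> p \<le> q \<Longrightarrow> f p \<le> f q" "\<And>p. c \<le> p \<Longrightarrow> 0 \<le> f p"
  shows "(\<Prod>i<card P. f (c + 2 * i)) \<le> prod f P"
  using assms(1,2)
proof (induction "card P" arbitrary: P)
  case (Suc w)
  have ne: "P \<noteq> {}" using Suc.hyps(2) by auto
  have M: "Max P \<in> P" "c + 2 * w \<le> Max P"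
    using Max_in[of P] ne Suc.prems Suc.hyps(2) Max_odd_ge[of P c] assms(3) by auto
  have w: "w = card (P - {Max P})" using Suc.hyps(2) Suc.prems(1) M(1) by simp
  have "(\<Prod>i<w. f (c + 2 * i)) \<le> prod f (P - {Max P})"
    using Suc.hyps(1)[OF w] Suc.prems w by auto
  moreover have "f (c + 2 * w) \<le> f (Max P)" using M assms(4) by simp
  ultimately have "(\<Prod>i<w. f (c + 2 * i)) * f (c + 2 * w) \<le> prod f (P - {Max P}) * f (Max P)"
    using assms(5) Suc.prems by (intro mult_mono prod_nonneg) auto
  also have "\<dots> = prod f P" using Suc.prems M by (simp add: prod.remove mult.commute)
  finally show ?case using Suc.hyps(2)[symmetric] by simp
qed auto

section \<open>Violators of Hall's condition\<close>

text \<open>Non-coprimality is symmetric, so the smaller of the two sets can be called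
  \<open>S\<close>. The bound \<open>6 * m + 2\<close> comes from l + 2 k <= 3 k - 1 together with k
  <= 2 m + 1.\<close>

locale hall_violator =
  fixes a b m :: nat and S T :: "nat set"
  assumes S: "S \<subseteq> {..<m}" and T: "T \<subseteq> {..<m}" and S_ne: "S \<noteq> {}"
    and card_ST: "card S + card T = m + 1" and card_S: "2 * card S \<le> m + 1"
    and not_coprime: "\<And>i j. i \<in> S \<Longrightarrow> j \<in> T \<Longrightarrow> \<not> coprime (a + 2 * i) (b + 2 * j)"
    and parity: "odd (a + b)"
    and a_pos: "0 < a" and a_le: "\<And>i. i < m \<Longrightarrow> a + 2 * i \<le> 6 * m + 2"
begin

abbreviation P where "P i \<equiv> odd_primes (a + 2 * i)"

lemma finite_S: "finite S"
  using S finite_subset by blast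

lemma finite_P: "finite (P i)"
  using a_pos by (simp add: finite_odd_primes)

lemma T_subset:
  assumes "i \<in> S"
  shows "T \<subseteq> {j. j < m \<and> (\<exists>p\<in>P i. p dvd b + 2 * j)}"
  using assms T not_coprime coprime_iff_odd_primes[of "a + 2 * i"] parity by fastforce

lemma S_less: "i \<in> S \<Longrightarrow> i < m"
  using S by auto

lemma prod_P_le:
  assumes "i < m" "Q \<subseteq> P i"
  shows "\<Prod>Q \<le> 6 * m + 2"
proof -
  have "\<Prod>Q dvd a + 2 * i"
    using assms finite_P finite_subset
    by (intro prod_primes_dvd_of_all_dvd) (auto simp: odd_primes_def)
  then have "\<Prod>Q \<le> a + 2 * i" using a_pos by (intro dvd_imp_le) auto
  also have "\<dots> \<le> 6 * m + 2" using assms a_le by auto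
  finally show ?thesis .
qed

text \<open>The sifted indices belong to partners coprime to \<open>a + 2 * i\<close>. They avoid
  \<open>T\<close>, and \<open>m - card T\<close> is \<open>card S - 1\<close>.\<close>

lemma card_sifted_less:
  assumes "i \<in> S"
  shows "card (sifted 2 b m (P i)) < card S"
proof -
  have "T \<inter> sifted 2 b m (P i) = {}" using T_subset[OF assms] by (auto simp: sifted_def)
  moreover have "T \<union> sifted 2 b m (P i) \<subseteq> {..<m}" using T by (auto simp: sifted_def)
  moreover have "finite T" using T finite_subset by blast
  ultimately have "card T + card (sifted 2 b m (P i)) \<le> card {..<m}"
    by (metis card_Un_disjoint card_mono finite_lessThan finite_sifted)
  then show ?thesis using card_ST by simp
qed

lemma sieve_bound:
  assumes "i \<in> S"
  shows "real m * (\<Prod>p\<in>P i. 1 - 1 / real p) \<le> real (card S) + 2 ^ card (P i) - 2"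
proof -
  have "\<bar>real (card (sifted 2 b m (P i))) - real m * (\<Prod>p\<in>P i. 1 - 1 / real p)\<bar>
      \<le> 2 ^ card (P i) - 1"
    using finite_P odd_primes_coprime_2
    by (intro card_sifted_approx) (auto simp: odd_primes_def)
  moreover have "real (card (sifted 2 b m (P i))) + 1 \<le> real (card S)"
    using card_sifted_less[OF assms] by linarith
  ultimately show ?thesis by linarith
qed

text \<open>\<open>T\<close> is covered by the multiples of the primes in \<open>P i\<close>. The
  error here is linear in the number of primes, whereas that of the sieve is exponential; so this
  bound serves when the primes are few and \<open>m\<close> is small.\<close>

lemma union_bound:
  assumes "i \<in> S"
  shows "real (card T) \<le> (real m - 1) * (\<Sum>p\<in>P i. 1 / real p) + real (card (P i))"
proof -
  have "card T \<le> card (\<Union>p\<in>P i. {j. j < m \<and> p dvd b + 2 * j})"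
    using T_subset[OF assms] finite_P by (intro card_mono) auto
  also have "\<dots> \<le> (\<Sum>p\<in>P i. card {j. j < m \<and> p dvd b + 2 * j})"
    using finite_P by (rule card_UN_le)
  finally have "real (card T) \<le> real (\<Sum>p\<in>P i. card {j. j < m \<and> p dvd b + 2 * j})"
    by linarith
  also have "\<dots> = (\<Sum>p\<in>P i. real (card {j. j < m \<and> p dvd b + 2 * j}))" by simp
  also have "\<dots> \<le> (\<Sum>p\<in>P i. (real m - 1) * (1 / real p) + 1)"
  proof (rule sum_mono)
    fix p assume p: "p \<in> P i"
    have p0: "0 < p" "coprime p 2" using odd_primes_ge_3[OF p] odd_primes_coprime_2[OF p] by auto
    have "real (card {j. j < m \<and> p dvd b + 2 * j}) \<le> (real m + real p - 1) / real p"
      using p0 by (intro card_multiples_le)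
    also have "\<dots> = (real m - 1) * (1 / real p) + 1"
      using p0 by (simp add: field_simps)
    finally show "real (card {j. j < m \<and> p dvd b + 2 * j}) \<le> (real m - 1) * (1 / real p) + 1" .
  qed
  also have "\<dots> = (real m - 1) * (\<Sum>p\<in>P i. 1 / real p) + real (card (P i))"
    by (simp add: sum.distrib sum_distrib_left)
  finally show ?thesis .
qed

text \<open>Multiples of 3 are counted first, and those of any other prime only outside them, which
  cuts their share by the factor 2/3.\<close>

lemma union_bound_3:
  assumes "i \<in> S" "3 \<in> P i"
  shows "real (card T) \<le> (real m + 2) / 3 +
    2 / 3 * ((real m - 1) * (\<Sum>p\<in>P i - {3}. 1 / real p) + 2 * real (card (P i - {3})))"
proof -
  let ?A = "\<lambda>p. {j. j < m \<and> p dvd b + 2 * j \<and> \<not> 3 dvd b + 2 * j}"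
  have "card T \<le> card ({j. j < m \<and> 3 dvd b + 2 * j} \<union> (\<Union>p\<in>P i - {3}. ?A p))"
    using T_subset[OF assms(1)] finite_P by (intro card_mono) auto
  also have "\<dots> \<le> card {j. j < m \<and> 3 dvd b + 2 * j} + card (\<Union>p\<in>P i - {3}. ?A p)"
    by (rule card_Un_le)
  also have "card (\<Union>p\<in>P i - {3}. ?A p) \<le> (\<Sum>p\<in>P i - {3}. card (?A p))"
    using finite_P by (intro card_UN_le) auto
  finally have "real (card T) \<le> real (card {j. j < m \<and> 3 dvd b + 2 * j} + (\<Sum>p\<in>P i - {3}. card (?A p)))"
    by linarith
  also have "\<dots> = real (card {j. j < m \<and> 3 dvd b + 2 * j}) + (\<Sum>p\<in>P i - {3}. real (card (?A p)))"
    by simp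
  also have "real (card {j. j < m \<and> 3 dvd b + 2 * j}) \<le> (real m + 2) / 3"
    using card_multiples_le[of 3 2 m b] by simp
  also have "(\<Sum>p\<in>P i - {3}. real (card (?A p))) \<le>
      (\<Sum>p\<in>P i - {3}. 2 / 3 * ((real m - 1) * (1 / real p) + 2))"
  proof (rule sum_mono)
    fix p assume p: "p \<in> P i - {3}"
    then have p0: "0 < p" "coprime p 2" "prime p"
      using p odd_primes_coprime_2[of p] by (auto simp: odd_primes_def prime_gt_0_nat)
    have "coprime 3 p" using p p0 by (intro primes_coprime) auto
    then have "coprime 3 (2 * p)" by simp
    then have "real (card (?A p)) \<le> (1 - 1 / real 3) * ((real m + real p - 1) / real p + 1)"
      using p0 by (intro card_multiples_sifted_le) auto
    also have "\<dots> = 2 / 3 * ((real m - 1) * (1 / real p) + 2)"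
      using p0 by (simp add: field_simps)
    finally show "real (card (?A p)) \<le> 2 / 3 * ((real m - 1) * (1 / real p) + 2)" .
  qed
  also have "\<dots> = 2 / 3 * ((real m - 1) * (\<Sum>p\<in>P i - {3}. 1 / real p) + 2 * real (card (P i - {3})))"
    by (simp add: sum.distrib sum_distrib_left algebra_simps)
  finally show ?thesis by simp
qed

lemma real_card_ST: "real (card S) + real (card T) = real m + 1"
  using arg_cong[OF card_ST, of real] by simp

lemma real_card_S: "real (card S) \<le> (real m + 1) / 2"
  using card_S by simp

end

section \<open>The range 9 <= m < 100000\<close>

lemma sum_inverse_odd:
  "(\<Sum>i<1. 1 / real (5 + 2 * i)) = 1 / 5"
  "(\<Sum>i<2. 1 / real (5 + 2 * i)) = 12 / 35"
  "(\<Sum>i<3. 1 / real (5 + 2 * i)) = 143 / 315"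
  by (simp_all add: eval_nat_numeral)

lemma prod_odd:
  "(\<Prod>i<3. real (5 + 2 * i)) = 315"
  "(\<Prod>i<4. real (5 + 2 * i)) = 3465"
  "(\<Prod>i<5. real (5 + 2 * i)) = 45045"
  "(\<Prod>i<6. real (5 + 2 * i)) = 675675"
  by (simp_all add: eval_nat_numeral)

lemma prod_one_minus_inverse_odd:
  "(\<Prod>i<4. 1 - 1 / real (5 + 2 * i)) = 128 / 231"
  "(\<Prod>i<5. 1 - 1 / real (5 + 2 * i)) = 512 / 1001"
  by (simp_all add: eval_nat_numeral)

context hall_violator
begin

text \<open>If 3 is missing, w primes in \<open>P i\<close> force 6 m + 2 >= 5 * 7 * 9 * ... with w
  factors. For each w, counting bounds \<open>m\<close> from above in conflict with this or with 9
  <= m.\<close>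

lemma mid_range_3_in_P:
  assumes i: "i \<in> S" and m: "9 \<le> m" "m < 100000"
  shows "3 \<in> P i"
proof (rule ccontr)
  assume n3: "3 \<notin> P i"
  have P: "odd p \<and> 5 \<le> p" if "p \<in> P i" for p
  proof -
    have "odd p" "3 \<le> p" "p \<noteq> 3"
      using that odd_primes_ge_3 n3 by (auto simp: odd_primes_def)
    then show ?thesis by (cases "p = 4") auto
  qed
  have prod_le: "(\<Prod>i<card Q. real (5 + 2 * i)) \<le> 6 * real m + 2" if "Q \<subseteq> P i" for Q
  proof -
    have "finite Q" using that finite_P finite_subset by blast
    moreover have "odd p \<and> 5 \<le> p" if "p \<in> Q" for p using P that \<open>Q \<subseteq> P i\<close> by blast
    ultimately have "(\<Prod>i<card Q. real (5 + 2 * i)) \<le> (\<Prod>p\<in>Q. real p)"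
      by (intro prod_odd_ge) auto
    also have "\<dots> = real (\<Prod>Q)" by simp
    also have "\<dots> \<le> 6 * real m + 2" using prod_P_le[OF S_less[OF i] that] by linarith
    finally show ?thesis .
  qed
  \<comment> \<open>Six factors give 675675, which exceeds 6 m + 2 for all m < 100000; this fixes
    the upper end of the range.\<close>
  have "card (P i) < 6"
  proof (rule ccontr)
    assume "\<not> card (P i) < 6"
    then obtain Q where Q: "Q \<subseteq> P i" "card Q = 6"
      using obtain_subset_with_card_n[of 6 "P i"] by (auto simp: not_less)
    show False using prod_le[OF Q(1), unfolded Q(2) prod_odd] m by simp
  qed
  then consider "card (P i) = 0" | "card (P i) = 1" | "card (P i) = 2" | "card (P i) = 3"
    | "card (P i) = 4" | "card (P i) = 5" by linarith
  note cases = this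
  have T_ge: "real m + 1 \<le> 2 * real (card T)" using real_card_ST real_card_S by argo
  have sum_le: "(\<Sum>p\<in>P i. 1 / real p) \<le> (\<Sum>i<card (P i). 1 / real (5 + 2 * i))"
    using P finite_P by (intro sum_odd_le) (auto intro: divide_left_mono)
  have T_le: "real (card T) \<le>
      (real m - 1) * (\<Sum>i<card (P i). 1 / real (5 + 2 * i)) + real (card (P i))"
  proof -
    have "(real m - 1) * (\<Sum>p\<in>P i. 1 / real p)
        \<le> (real m - 1) * (\<Sum>i<card (P i). 1 / real (5 + 2 * i))"
      using sum_le m by (intro mult_left_mono) auto
    with union_bound[OF i] show ?thesis by linarith
  qed
  have "(\<Prod>i<card (P i). 1 - 1 / real (5 + 2 * i)) \<le> (\<Prod>p\<in>P i. 1 - 1 / real p)"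
    using P finite_P by (intro prod_odd_ge) (auto simp: frac_le)
  then have "real m * (\<Prod>i<card (P i). 1 - 1 / real (5 + 2 * i))
      \<le> real m * (\<Prod>p\<in>P i. 1 - 1 / real p)"
    by (intro mult_left_mono) auto
  also have "\<dots> \<le> real (card S) + 2 ^ card (P i) - 2" by (rule sieve_bound[OF i])
  finally have sieve: "real m * (\<Prod>i<card (P i). 1 - 1 / real (5 + 2 * i))
      \<le> (real m + 1) / 2 + 2 ^ card (P i) - 2"
    using real_card_S by argo
  note prod_le = prod_le[OF subset_refl]
  show False
    using cases
  proof cases
    case 1
    then show False using T_le T_ge m by simp
  next
    case 2
    show False using T_le[unfolded 2 sum_inverse_odd] T_ge m by (simp add: field_simps)
  next
    case 3
    show False using T_le[unfolded 3 sum_inverse_odd] T_ge m by (simp add: field_simps)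
  next
    case 4
    show False using T_le[unfolded 4 sum_inverse_odd] T_ge prod_le[unfolded 4 prod_odd]
        by (simp add: field_simps)
  next
    \<comment> \<open>Since 1/5 + 1/7 + 1/9 + 1/11 > 1/2, the union bound fails from four primes on
      and the sieve takes over. It gives m < 268 against m > 577 from the product and, for five
      primes, m < 2655 against m > 7507.\<close>
    case 5
    show False
      using sieve[unfolded 5 prod_one_minus_inverse_odd] prod_le[unfolded 5 prod_odd]
      by (simp add: field_simps)
  next
    case 6
    show False
      using sieve[unfolded 6 prod_one_minus_inverse_odd] prod_le[unfolded 6 prod_odd]
      by (simp add: field_simps)
  qed
qed

text \<open>As 3 divides every term indexed by \<open>S\<close>, that set has at most (m + 2) / 3
  members and \<open>T\<close> at least (2 m + 1) / 3. The counting is repeated with 3 split off; it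
  leaves only terms with exactly two further odd primes, and then only 105.\<close>

lemma mid_range_False:
  assumes m: "9 \<le> m" "m < 100000"
  shows False
proof -
  have in_P: "3 \<in> P i" if "i \<in> S" for i using that m by (rule mid_range_3_in_P)
  have "card S \<le> card {i. i < m \<and> 3 dvd a + 2 * i}"
    using S in_P by (intro card_mono) (auto simp: odd_primes_def)
  also have "real \<dots> \<le> (real m + 2) / 3" using card_multiples_le[of 3 2 m a] by simp
  finally have S_le: "real (card S) \<le> (real m + 2) / 3" by simp
  then have T_ge: "2 * real m + 1 \<le> 3 * real (card T)" using real_card_ST by argo
  have P: "prime p \<and> odd p \<and> 5 \<le> p" if "p \<in> P i - {3}" for p i
  proof -
    have "prime p" "odd p" "3 \<le> p" "p \<noteq> 3"
      using that odd_primes_ge_3 by (auto simp: odd_primes_def)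
    then show ?thesis by (cases "p = 4") auto
  qed
  have T_le: "real (card T) \<le> (real m + 2) / 3 + 2 / 3 * ((real m - 1) *
      (\<Sum>i<card (P i - {3}). 1 / real (5 + 2 * i)) + 2 * real (card (P i - {3})))"
    if i: "i \<in> S" for i
  proof -
    have "(\<Sum>p\<in>P i - {3}. 1 / real p) \<le> (\<Sum>i<card (P i - {3}). 1 / real (5 + 2 * i))"
      using P finite_P by (intro sum_odd_le) (auto intro: divide_left_mono)
    then have "(real m - 1) * (\<Sum>p\<in>P i - {3}. 1 / real p)
        \<le> (real m - 1) * (\<Sum>i<card (P i - {3}). 1 / real (5 + 2 * i))"
      using m by (intro mult_left_mono) auto
    then show ?thesis
      by (intro order_trans[OF union_bound_3[OF i in_P[OF i]]] add_left_mono
          mult_left_mono[of "_ + _"] add_right_mono) auto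
  qed
  have small: "m \<le> 26 \<and> card (P i - {3}) = 2" if i: "i \<in> S" for i
  proof -
    have prod_le: "3 * (\<Prod>i<card Q. real (5 + 2 * i)) \<le> 6 * real m + 2" if Q: "Q \<subseteq> P i - {3}" for Q
    proof -
      have "finite Q" using Q finite_P finite_subset by blast
      moreover have "odd p \<and> 5 \<le> p" if "p \<in> Q" for p using P that Q by blast
      ultimately have "(\<Prod>i<card Q. real (5 + 2 * i)) \<le> (\<Prod>p\<in>Q. real p)"
        by (intro prod_odd_ge) auto
      also have "3 * \<dots> = real (\<Prod>(insert 3 Q))"
        using Q \<open>finite Q\<close> by (subst prod.insert) auto
      also have "\<dots> \<le> real (6 * m + 2)"
        unfolding of_nat_le_iff using Q in_P[OF i] by (intro prod_P_le[OF S_less[OF i]]) auto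
      also have "\<dots> = 6 * real m + 2" by simp
      finally show ?thesis by simp
    qed
    have "card (P i - {3}) < 6"
    proof (rule ccontr)
      assume "\<not> card (P i - {3}) < 6"
      then obtain Q where Q: "Q \<subseteq> P i - {3}" "card Q = 6"
        using obtain_subset_with_card_n[of 6 "P i - {3}"] by (auto simp: not_less)
      show False using prod_le[OF Q(1), unfolded Q(2) prod_odd] m by simp
    qed
    then consider "card (P i - {3}) = 0" | "card (P i - {3}) = 1" | "card (P i - {3}) = 2"
      | "card (P i - {3}) = 3" | "card (P i - {3}) = 4" | "card (P i - {3}) = 5" by linarith
    note cases = this
    have "(\<Prod>i<card (P i - {3}). 1 - 1 / real (5 + 2 * i)) \<le> (\<Prod>p\<in>P i - {3}. 1 - 1 / real p)"
      using P finite_P by (intro prod_odd_ge) (auto simp: frac_le)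
    then have "real m * (2 / 3) * (\<Prod>i<card (P i - {3}). 1 - 1 / real (5 + 2 * i))
        \<le> real m * (2 / 3) * (\<Prod>p\<in>P i - {3}. 1 - 1 / real p)"
      by (intro mult_left_mono) auto
    also have "\<dots> = real m * (\<Prod>p\<in>P i. 1 - 1 / real p)"
      using finite_P in_P[OF i] by (simp add: prod.remove[of "P i" 3])
    also have "\<dots> \<le> real (card S) + 2 ^ card (P i) - 2" by (rule sieve_bound[OF i])
    also have "card (P i) = Suc (card (P i - {3}))"
      using finite_P in_P[OF i] by (metis card_Suc_Diff1)
    finally have sieve: "real m * (2 / 3) * (\<Prod>i<card (P i - {3}). 1 - 1 / real (5 + 2 * i))
        \<le> (real m + 2) / 3 + 2 ^ Suc (card (P i - {3})) - 2" using S_le by argo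
    note prod_le = prod_le[OF subset_refl]
    show ?thesis
      using cases
    proof cases
      case 1
      then have False using T_le[OF i] T_ge m by simp
      then show ?thesis ..
    next
      case 2
      have False using T_le[OF i, unfolded 2 sum_inverse_odd] T_ge m by (simp add: field_simps)
      then show ?thesis ..
    next
      \<comment> \<open>Here the bound does not yet contradict 9 <= m. It leaves m <= 26, which is
        settled below.\<close>
      case 3
      have "11 * real m \<le> 291"
        using T_le[OF i, unfolded 3 sum_inverse_odd] T_ge by (simp add: field_simps)
      then have "m \<le> 26" by linarith
      with 3 show ?thesis by blast
    next
      case 4
      have False
        using T_le[OF i, unfolded 4 sum_inverse_odd] T_ge prod_le[unfolded 4 prod_odd]
        by (simp add: field_simps)
      then show ?thesis ..
    next
      case 5
      have False
        using sieve[unfolded 5 prod_one_minus_inverse_odd] prod_le[unfolded 5 prod_odd]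
      by (simp add: field_simps)
      then show ?thesis ..
    next
      case 6
      have False
        using sieve[unfolded 6 prod_one_minus_inverse_odd] prod_le[unfolded 6 prod_odd]
      by (simp add: field_simps)
      then show ?thesis ..
    qed
  qed
  obtain i0 where i0: "i0 \<in> S" using S_ne by blast
  have m26: "m \<le> 26" using small i0 by blast
  \<comment> \<open>For m <= 26 the terms are at most 158, and 3 * 5 * 7 is the only product of 3
    and two larger primes below that.\<close>
  have eq: "a + 2 * i = 105" if i: "i \<in> S" for i
  proof -
    obtain p q where pq: "P i - {3} = {p, q}" "p < q"
    proof -
      obtain p q where "P i - {3} = {p, q}" "p \<noteq> q"
        using small[OF i] card_2_iff[of "P i - {3}"] by blast
      then show ?thesis using that[of p q] that[of q p] by (cases "p < q") auto
    qed
    have prime: "prime q" "odd p" "odd q" "5 \<le> p" using P[of _ i] pq by auto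
    have P_eq: "P i = {3, p, q}" using pq in_P[OF i] by blast
    have "\<Prod>(P i) = 3 * (p * q)"
      using pq prime P_eq by simp
    note prod_eq = this
    have "\<Prod>(P i) dvd a + 2 * i"
      by (rule prod_primes_dvd_of_all_dvd[OF finite_P]) (auto simp: odd_primes_def)
    then have dvd: "3 * (p * q) dvd a + 2 * i" unfolding prod_eq .
    have "\<Prod>(P i) \<le> 6 * m + 2" by (rule prod_P_le[OF S_less[OF i] subset_refl])
    then have "3 * (p * q) \<le> 158" unfolding prod_eq using m26 by linarith
    then have le: "p * q \<le> 52" by linarith
    have "p < 7"
    proof (rule ccontr)
      assume "\<not> p < 7"
      then have "7 * 8 \<le> p * q" using pq by (intro mult_le_mono) auto
      with le show False by simp
    qed
    then have p: "p = 5" using prime by (cases "p = 6") auto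
    then have "q \<le> 10" "5 < q" using le pq by auto
    then have "q \<in> {6, 7, 8, 9, 10}" by auto
    moreover have "q \<noteq> 9"
    proof
      assume "q = 9"
      then have "q = 3 * 3" by simp
      with prime(1) prime_product[of 3 3] show False by simp
    qed
    ultimately have "q = 7" using prime by auto
    with p dvd have "105 dvd a + 2 * i" by simp
    moreover have "a + 2 * i \<le> 158" "0 < a + 2 * i" using a_le[of i] i S m26 a_pos by auto
    ultimately show ?thesis by (auto elim!: dvdE)
  qed
  have "i = i0" if "i \<in> S" for i using eq[OF that] eq[OF i0] by simp
  then have "S = {i0}" using i0 by blast
  then have "real (card T) = real m" using card_ST by simp
  moreover have two: "card (P i0 - {3}) = 2" using small[OF i0] by blast
  \<comment> \<open>Now \<open>T\<close> contains all \<open>m\<close> indices, and the bound for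
    two further primes becomes 46 m <= 326.\<close>
  ultimately show False using T_le[OF i0, unfolded two sum_inverse_odd] m
    by (simp add: field_simps)
qed

end

section \<open>Estimates for products over odd primes\<close>

lemma odd_prime_cases:
  assumes "prime (p::nat)" "odd p"
  shows "p = 3 \<or> p = 5 \<or> p = 7 \<or> 11 \<le> p"
proof (rule ccontr)
  assume *: "\<not> ?thesis"
  then have "p = 0 \<or> p = 1 \<or> p = 2 \<or> p = 4 \<or> p = 6 \<or> p = 8 \<or> p = 9 \<or> p = 10" by arith
  moreover have "p \<noteq> 9"
  proof
    assume "p = 9"
    then have "p = 3 * 3" by simp
    with assms(1) prime_product[of 3 3] show False by simp
  qed
  ultimately show False using assms by auto
qed

text \<open>Factors from 7 on can only lower the product, and those at 3 and 5 can only raise it, so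
  the set {3, 5} is the extreme case.\<close>

lemma prod_odd_primes_le:
  fixes f :: "nat \<Rightarrow> real"
  assumes "finite D" "\<And>p. p \<in> D \<Longrightarrow> prime p \<and> odd p"
    and "\<And>p. 0 \<le> f p" "1 \<le> f 3" "1 \<le> f 5" "\<And>p. 7 \<le> p \<Longrightarrow> f p \<le> 1"
  shows "prod f D \<le> f 3 * f 5"
proof -
  have "prod f D = prod f (D \<inter> {3, 5}) * prod f (D - {3, 5})"
    by (rule prod.Int_Diff[OF assms(1)])
  also have "\<dots> \<le> prod f {3, 5} * 1"
  proof (rule mult_mono)
    show "prod f (D \<inter> {3, 5}) \<le> prod f {3, 5}" using assms by (intro prod_mono2) auto
    have "7 \<le> p" if "p \<in> D - {3, 5}" for p
      using that assms(2)[of p] odd_prime_cases[of p] by auto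
    then show "prod f (D - {3, 5}) \<le> 1"
      using assms(3,6) by (intro prod_le_1) auto
  qed (use assms in \<open>auto intro: prod_nonneg\<close>)
  finally show ?thesis by simp
qed

lemma sqrt_prod: "sqrt (\<Prod>i\<in>A. f i) = (\<Prod>i\<in>A. sqrt (f i))"
  by (induction A rule: infinite_finite_induct) (auto simp: real_sqrt_mult)

lemma sqrt_15_bounds: "15 / 4 \<le> sqrt 15" "sqrt 15 \<le> 4" "sqrt 3 * sqrt 5 = sqrt 15"
proof -
  show "15 / 4 \<le> sqrt 15" by (rule real_le_rsqrt) (simp add: power2_eq_square)
  show "sqrt 15 \<le> 4" by (rule real_le_lsqrt) auto
  show "sqrt 3 * sqrt 5 = sqrt 15" by (simp flip: real_sqrt_mult)
qed

text \<open>Compares the sieve error with the sieve's main term. Each prime contributes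
  \<open>f p\<close>, which is at most 1 from 7 on, and \<open>f 3 * f 5\<close> is 15 / (2 sqrt 15)
  <= 2.\<close>

lemma two_power_card_le:
  assumes "finite D" "\<And>p. p \<in> D \<Longrightarrow> prime p \<and> odd p"
  shows "2 ^ card D \<le> 2 * (\<Prod>p\<in>D. 1 - 1 / real p) * sqrt (\<Prod>D)"
proof -
  define f where "f = (\<lambda>p. if 3 \<le> p then 2 / ((1 - 1 / real p) * sqrt (real p)) else 0)"
  have D3: "3 \<le> p" if "p \<in> D" for p using odd_prime_cases[of p] assms(2)[OF that] by auto
  have f3: "f 3 = 3 / sqrt 3" and f5: "f 5 = (5 / 2) / sqrt 5" by (auto simp: f_def)
  have "prod f D \<le> f 3 * f 5"
  proof (rule prod_odd_primes_le[OF assms])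
    show "1 \<le> f 3" unfolding f3 by (simp add: le_divide_eq real_le_lsqrt)
    have "sqrt 5 \<le> 5 / 2" by (rule real_le_lsqrt) (auto simp: power2_eq_square)
    then show "1 \<le> f 5" unfolding f5 by (simp add: le_divide_eq)
    show "f p \<le> 1" if p: "7 \<le> p" for p
    proof -
      obtain t where t: "real p = 7 + t" "0 \<le> t" using p
        using that[of "real p - 7"] by simp
      have "2 * sqrt (real p) \<le> real p - 1"
      proof -
        have "sqrt (real p) \<le> (real p - 1) / 2"
          using t by (intro real_le_lsqrt) (auto simp: power2_eq_square field_simps)
        then show ?thesis by simp
      qed
      then have "2 * sqrt (real p) * sqrt (real p) \<le> (real p - 1) * sqrt (real p)"
        by (intro mult_right_mono) auto
      then have "2 * real p \<le> (real p - 1) * sqrt (real p)" by (simp add: mult.assoc)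
      moreover have "(1 - 1 / real p) * sqrt (real p) = (real p - 1) * sqrt (real p) / real p"
        using p by (simp add: field_simps)
      ultimately have "2 \<le> (1 - 1 / real p) * sqrt (real p)" using p by (simp add: le_divide_eq)
      then show ?thesis by (auto simp: f_def divide_le_eq)
    qed
  qed (auto simp: f_def)
  also have "f 3 * f 5 = (15 / 2) / sqrt 15"
    unfolding f3 f5 sqrt_15_bounds(3)[symmetric] by simp
  also have "\<dots> \<le> 2" using sqrt_15_bounds(1) by (simp add: divide_le_eq)
  finally have "prod f D \<le> 2" .
  moreover have pos: "0 < (\<Prod>p\<in>D. (1 - 1 / real p) * sqrt (real p))"
    using D3 by (intro prod_pos mult_pos_pos) (fastforce simp: divide_less_eq)+
  moreover have "prod f D = 2 ^ card D / (\<Prod>p\<in>D. (1 - 1 / real p) * sqrt (real p))"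
    using D3 by (simp add: f_def prod_dividef)
  ultimately have "2 ^ card D \<le> 2 * (\<Prod>p\<in>D. (1 - 1 / real p) * sqrt (real p))"
    by (simp add: divide_le_eq)
  then show ?thesis by (simp add: prod.distrib sqrt_prod)
qed

text \<open>\<open>1 + gain p\<close> is the Euler factor 1 / (1 - 1/p)^2. Expanding its product
  over the odd primes of x writes 1 / c(x)^2 as the sum of \<open>prod gain D\<close> over all sets
  \<open>D\<close> of such primes.\<close>

definition gain :: "nat \<Rightarrow> real" where
  "gain p = (2 * real p - 1) / (real p - 1)\<^sup>2"

lemma gain_nonneg: "1 \<le> p \<Longrightarrow> 0 \<le> gain p"
  by (simp add: gain_def)

lemma one_plus_gain: "2 \<le> p \<Longrightarrow> 1 + gain p = 1 / (1 - 1 / real p)\<^sup>2"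
  by (simp add: gain_def power2_eq_square divide_simps) (simp add: algebra_simps)

text \<open>Bounds the rounding error that \<open>D\<close> contributes to the second moment by a
  quantity easily summed over odd numbers. As \<open>gain p\<close> is about 2/p,
  \<open>gain p * sqrt p\<close> is at most 1 from 7 on.\<close>

lemma prod_gain_le:
  assumes "finite D" "\<And>p. p \<in> D \<Longrightarrow> prime p \<and> odd p"
  shows "prod gain D \<le> 3 / sqrt (\<Prod>D)"
proof -
  define f where "f = (\<lambda>p. if 3 \<le> p then gain p * sqrt (real p) else 0)"
  have D3: "3 \<le> p" if "p \<in> D" for p using odd_prime_cases[of p] assms(2)[OF that] by auto
  have f3: "f 3 = 5 / 4 * sqrt 3" and f5: "f 5 = 9 / 16 * sqrt 5"
    by (auto simp: f_def gain_def)
  have "prod f D \<le> f 3 * f 5"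
  proof (rule prod_odd_primes_le[OF assms])
    have "1 \<le> sqrt (3::real)" by simp
    then show "1 \<le> f 3" unfolding f3 by linarith
    have "2 \<le> sqrt (5::real)" by (rule real_le_rsqrt) simp
    then show "1 \<le> f 5" unfolding f5 by linarith
    show "f p \<le> 1" if p: "7 \<le> p" for p
    proof -
      \<comment> \<open>With p = 7 + t, the inequality below becomes the nonnegativity of a
        polynomial in \<open>t\<close> whose coefficients are all nonnegative.\<close>
      obtain t where t: "real p = 7 + t" "0 \<le> t" using p
        using that[of "real p - 7"] by simp
      have "real p * (2 * real p - 1)\<^sup>2 \<le> ((real p - 1)\<^sup>2)\<^sup>2"
        unfolding t using t(2) by (simp add: power2_eq_square algebra_simps)
      then have "real p \<le> ((real p - 1)\<^sup>2 / (2 * real p - 1))\<^sup>2"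
        using t by (simp add: power_divide le_divide_eq)
      then have "sqrt (real p) \<le> (real p - 1)\<^sup>2 / (2 * real p - 1)"
        using t by (intro real_le_lsqrt) auto
      then have "(2 * real p - 1) * sqrt (real p) \<le> (real p - 1)\<^sup>2"
        using t by (simp add: le_divide_eq mult.commute)
      then show ?thesis by (auto simp: f_def gain_def divide_le_eq)
    qed
  qed (auto simp: f_def gain_nonneg)
  also have "f 3 * f 5 = 45 / 64 * sqrt 15"
    unfolding f3 f5 sqrt_15_bounds(3)[symmetric] by simp
  also have "\<dots> \<le> 3" using sqrt_15_bounds(2) by simp
  finally have "prod f D \<le> 3" .
  moreover have "prod f D = prod gain D * sqrt (\<Prod>D)"
    using D3 by (simp add: f_def prod.distrib sqrt_prod)
  moreover have "0 < \<Prod>D" by (rule prod_pos) (meson D3 less_le_trans zero_less_numeral)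
  then have "0 < sqrt (real (\<Prod>D))" by (simp del: of_nat_prod)
  ultimately show ?thesis by (simp add: le_divide_eq)
qed

text \<open>The quotients (10 + 2 i) / (8 + 2 i) and (9 + 2 i) / (11 + 2 i) telescope
  separately.\<close>

lemma prod_telescope:
  "(\<Prod>i<n. (10 + 2 * real i) * (9 + 2 * real i) / ((11 + 2 * real i) * (8 + 2 * real i)))
    = 9 / 8 * ((8 + 2 * real n) / (9 + 2 * real n))"
proof (induction n)
  case (Suc n)
  show ?case unfolding prod.lessThan_Suc Suc by (simp add: divide_simps) (simp add: algebra_simps)
qed auto

text \<open>The factors at 3, 5 and 7 are exact, 17/12 * 89/80 * 265/252 < 1.66. Larger primes are
  replaced by all odd numbers from 11 on, at the cost of the telescoping factor 9/8.\<close>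

lemma euler_product_le:
  assumes "finite D" "\<And>p. p \<in> D \<Longrightarrow> prime p \<and> odd p"
  shows "(\<Prod>p\<in>D. 1 + gain p / real p) \<le> 19 / 10"
proof -
  let ?f = "\<lambda>p. 1 + gain p / real p"
  let ?R = "D - {3, 5, 7}"
  \<comment> \<open>For \<open>p = 11 + 2 i\<close> this is \<open>1 + 2 / (p (p - 3)) = (p - 1) (p - 2) / (p (p - 3))\<close>.\<close>
  let ?b = "\<lambda>i. (10 + 2 * real i) * (9 + 2 * real i) / ((11 + 2 * real i) * (8 + 2 * real i))"
  define N where "N = Suc (Max (insert 0 D))"
  have R: "odd p \<and> 11 \<le> p \<and> p < N" if "p \<in> ?R" for p
    using that assms odd_prime_cases[of p] by (auto simp: N_def less_Suc_eq_le)
  have "?R \<subseteq> (\<lambda>i. 11 + 2 * i) ` {..<N}"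
  proof
    fix p assume p: "p \<in> ?R"
    then have "even (p - 11)" using R[OF p] by auto
    then have "p = 11 + 2 * ((p - 11) div 2)" using R[OF p] by auto
    moreover have "(p - 11) div 2 < N" using R[OF p] by auto
    ultimately show "p \<in> (\<lambda>i. 11 + 2 * i) ` {..<N}" by blast
  qed
  then have "prod ?f ?R \<le> prod ?f ((\<lambda>i. 11 + 2 * i) ` {..<N})"
    by (intro prod_mono2) (auto simp: gain_def)
  also have "\<dots> = (\<Prod>i<N. ?f (11 + 2 * i))"
    by (subst prod.reindex) (auto simp: inj_on_def)
  also have "\<dots> \<le> (\<Prod>i<N. ?b i)"
  proof (rule prod_mono)
    fix i
    have "?f (11 + 2 * i) \<le> ?b i"
      by (simp add: gain_def power2_eq_square divide_simps) (simp add: algebra_simps)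
    moreover have "0 \<le> ?f (11 + 2 * i)" by (simp add: gain_def)
    ultimately show "0 \<le> ?f (11 + 2 * i) \<and> ?f (11 + 2 * i) \<le> ?b i" by blast
  qed
  also have "\<dots> = 9 / 8 * ((8 + 2 * real N) / (9 + 2 * real N))" by (rule prod_telescope)
  also have "\<dots> \<le> 9 / 8 * 1" by (intro mult_left_mono) auto
  finally have R_le: "prod ?f ?R \<le> 9 / 8" by simp
  have "prod ?f D = prod ?f (D \<inter> {3, 5, 7}) * prod ?f ?R"
    by (rule prod.Int_Diff[OF assms(1)])
  also have "\<dots> \<le> prod ?f {3, 5, 7} * (9 / 8)"
  proof (rule mult_mono)
    show "prod ?f (D \<inter> {3, 5, 7}) \<le> prod ?f {3, 5, 7}"
      by (intro prod_mono2) (auto simp: gain_def)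
    have "0 \<le> ?f p" if "p \<in> ?R" for p using gain_nonneg[of p] R[OF that] by simp
    then show "0 \<le> prod ?f ?R" by (intro prod_nonneg)
  qed (use R_le in \<open>auto simp: gain_def\<close>)
  also have "\<dots> \<le> 19 / 10" by (simp add: gain_def power2_eq_square)
  finally show ?thesis .
qed

text \<open>By concavity of the root each summand is at most sqrt (2 j + 2) - sqrt (2 j), and these
  differences telescope.\<close>

lemma sum_inverse_sqrt_odd_le: "(\<Sum>j<n. 1 / sqrt (2 * real j + 1)) \<le> sqrt (2 * real n)"
proof (induction n)
  case (Suc n)
  let ?x = "sqrt (2 * real n)" and ?y = "sqrt (2 * real n + 2)" and ?z = "sqrt (2 * real n + 1)"
  have "(?x + ?y)\<^sup>2 \<le> (2 * ?z)\<^sup>2"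
  proof -
    have "0 \<le> (?y - ?x)\<^sup>2" by simp
    then show ?thesis by (simp add: power2_sum power2_diff power_mult_distrib mult_ac)
  qed
  then have "?x + ?y \<le> 2 * ?z" by (rule power2_le_imp_le) auto
  moreover have "(?y - ?x) * (?x + ?y) = 2" by (simp add: algebra_simps flip: power2_eq_square)
  ultimately have "2 \<le> (?y - ?x) * (2 * ?z)"
    using mult_left_mono[of "?x + ?y" "2 * ?z" "?y - ?x"] by simp
  then have "1 / ?z \<le> ?y - ?x" by (simp add: divide_le_eq)
  with Suc show ?case by (simp add: algebra_simps)
qed auto

lemma prime_dvd_prod_primes_iff:
  assumes "finite D" "\<And>q. q \<in> D \<Longrightarrow> prime q" "prime (p::nat)"
  shows "p dvd \<Prod>D \<longleftrightarrow> p \<in> D"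
proof
  assume "p dvd \<Prod>D"
  then obtain q where "q \<in> D" "p dvd q" using assms by (auto simp: prime_dvd_prod_iff)
  then show "p \<in> D" using assms(2)[of q] assms(3) primes_dvd_imp_eq[of p q] by auto
qed (use assms in \<open>auto intro: dvd_prodI\<close>)

section \<open>The range m >= 100000: second moment\<close>

context hall_violator
begin

text \<open>The threshold enters here, as 6 * 120^2 = 86400 lies below it. The constant 120 makes
  the sieve error at most 1/60 of the main term and the remainder of the moment at most m /
  40.\<close>

lemma large_sqrt_le:
  assumes "100000 \<le> m"
  shows "sqrt (6 * real m + 2) \<le> real m / 120"
proof (rule real_le_lsqrt)
  have "14400 * (6 * x + 2) \<le> x * x" if "100000 \<le> x" for x :: real
    using mult_right_mono[OF that, of x] that by argo
  then have "14400 * (6 * real m + 2) \<le> real m * real m" using assms by simp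
  then show "6 * real m + 2 \<le> (real m / 120)\<^sup>2" by (simp add: power2_eq_square)
qed (use assms in auto)

lemma large_density_le:
  assumes "100000 \<le> m" and i: "i \<in> S"
  shows "59 / 60 * real m * (\<Prod>p\<in>P i. 1 - 1 / real p) \<le> real (card S)"
proof -
  let ?c = "\<Prod>p\<in>P i. 1 - 1 / real p"
  have c: "0 \<le> ?c"
    using odd_primes_ge_3 by (intro prod_nonneg) (force simp: divide_le_eq)
  have "real (\<Prod>(P i)) \<le> real (6 * m + 2)"
    unfolding of_nat_le_iff by (rule prod_P_le[OF S_less[OF i] subset_refl])
  then have "real (\<Prod>(P i)) \<le> 6 * real m + 2" by simp
  then have "sqrt (\<Prod>(P i)) \<le> sqrt (6 * real m + 2)" by (rule real_sqrt_le_mono)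
  also have "\<dots> \<le> real m / 120" by (rule large_sqrt_le[OF assms(1)])
  finally have "2 * ?c * sqrt (\<Prod>(P i)) \<le> 2 * ?c * (real m / 120)"
    using c by (intro mult_left_mono) auto
  moreover have "2 ^ card (P i) \<le> 2 * ?c * sqrt (\<Prod>(P i))"
    using finite_P by (intro two_power_card_le) (auto simp: odd_primes_def)
  ultimately have "2 ^ card (P i) \<le> real m * ?c / 60" by simp
  then show ?thesis using sieve_bound[OF i] by simp
qed

text \<open>The products are expanded over sets \<open>D\<close> and the sums exchanged. With d =
  \<open>\<Prod>D\<close>, at most m / d + 1 terms are divisible by d: the parts m / d yield the
  Euler product, at most 19/10, the units yield at most m / 40, and 19/10 + 1/40 = 77/40.\<close>

lemma large_moment_le:
  assumes m: "100000 \<le> m"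
  shows "(\<Sum>i<m. \<Prod>p\<in>P i. 1 + gain p) \<le> 77 / 40 * real m"
proof -
  define U where "U = {p. prime p \<and> odd p \<and> p \<le> 6 * m + 2}"
  \<comment> \<open>The product of primes dividing a term divides that term, so larger products
    never occur in the expansion. The cutoff keeps the remainder sum short.\<close>
  define DD where "DD = {D \<in> Pow U. \<Prod>D \<le> 6 * m + 2}"
  have finU: "finite U" by (rule finite_subset[of _ "{..6 * m + 2}"]) (auto simp: U_def)
  then have finDD: "finite DD" by (simp add: DD_def)
  have D: "finite D" "\<And>p. p \<in> D \<Longrightarrow> prime p \<and> odd p" if "D \<subseteq> U" for D
  proof -
    show "finite D" using that finU by (rule finite_subset)
    show "prime p \<and> odd p" if "p \<in> D" for p using that \<open>D \<subseteq> U\<close> by (auto simp: U_def)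
  qed
  have G0: "0 \<le> prod gain D" if "D \<subseteq> U" for D
    using D(2)[OF that] by (intro prod_nonneg gain_nonneg) (simp add: odd_pos Suc_leI)
  have Pow_P: "Pow (P i) = {D \<in> DD. D \<subseteq> P i}" if "i < m" for i
  proof -
    have "P i \<subseteq> U"
    proof
      fix p assume "p \<in> P i"
      then have p: "prime p" "odd p" "p dvd a + 2 * i" by (auto simp: odd_primes_def)
      then have "p \<le> a + 2 * i" using a_pos by (intro dvd_imp_le) auto
      also have "\<dots> \<le> 6 * m + 2" by (rule a_le[OF that])
      finally show "p \<in> U" using p by (simp add: U_def)
    qed
    then show ?thesis using prod_P_le[OF that] by (auto simp: DD_def)
  qed
  have "(\<Sum>i<m. \<Prod>p\<in>P i. 1 + gain p) = (\<Sum>i<m. \<Sum>D\<in>{D \<in> DD. D \<subseteq> P i}. prod gain D)"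
  proof (rule sum.cong)
    fix i assume "i \<in> {..<m}"
    then have "(\<Sum>D\<in>{D \<in> DD. D \<subseteq> P i}. prod gain D) = (\<Sum>D\<in>Pow (P i). prod gain D)"
      using Pow_P by simp
    also have "\<dots> = (\<Prod>p\<in>P i. gain p + 1)"
      by (subst prod_add[OF finite_P]) simp
    finally show "(\<Prod>p\<in>P i. 1 + gain p) = (\<Sum>D\<in>{D \<in> DD. D \<subseteq> P i}. prod gain D)"
      by (simp add: add.commute)
  qed auto
  also have "\<dots> = (\<Sum>D\<in>DD. \<Sum>i\<in>{i \<in> {..<m}. D \<subseteq> P i}. prod gain D)"
    using finDD by (intro sum.swap_restrict) auto
  also have "\<dots> \<le> (\<Sum>D\<in>DD. real m * (\<Prod>p\<in>D. gain p / real p) + 3 / sqrt (\<Prod>D))"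
  proof (rule sum_mono)
    fix D assume "D \<in> DD"
    then have DU: "D \<subseteq> U" by (simp add: DD_def)
    have pos: "0 < \<Prod>D" using D(2)[OF DU] by (intro prod_pos) (auto simp: prime_gt_0_nat)
    have "coprime (\<Prod>D) 2" using D(2)[OF DU] by (intro prod_coprime_left) auto
    then have "real (card {i. i < m \<and> \<Prod>D dvd a + 2 * i}) \<le> (real m + real (\<Prod>D) - 1) / real (\<Prod>D)"
      using pos by (rule card_multiples_le)
    also have "\<dots> \<le> real m / real (\<Prod>D) + 1"
    proof -
      have "(x + y - 1) / y \<le> x / y + 1" if "0 < y" for x y :: real
        using that by (simp add: field_simps)
      then show ?thesis using pos by (simp del: of_nat_prod)
    qed
    finally have "real (card {i. i < m \<and> \<Prod>D dvd a + 2 * i}) \<le> real m / real (\<Prod>D) + 1" .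
    moreover have "card {i \<in> {..<m}. D \<subseteq> P i} \<le> card {i. i < m \<and> \<Prod>D dvd a + 2 * i}"
      using D[OF DU]
      by (intro card_mono) (auto simp: odd_primes_def intro!: prod_primes_dvd_of_all_dvd)
    ultimately have card_le: "real (card {i \<in> {..<m}. D \<subseteq> P i}) \<le> real m / real (\<Prod>D) + 1"
      by linarith
    have "(\<Sum>i\<in>{i \<in> {..<m}. D \<subseteq> P i}. prod gain D) =
        real (card {i \<in> {..<m}. D \<subseteq> P i}) * prod gain D" by simp
    also have "\<dots> \<le> (real m / real (\<Prod>D) + 1) * prod gain D"
      using card_le G0[OF DU] by (intro mult_right_mono)
    also have "\<dots> = real m * (\<Prod>p\<in>D. gain p / real p) + prod gain D"
      by (simp add: prod_dividef distrib_right)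
    also have "\<dots> \<le> real m * (\<Prod>p\<in>D. gain p / real p) + 3 / sqrt (\<Prod>D)"
      using D[OF DU] by (intro add_left_mono prod_gain_le)
    finally show "(\<Sum>i\<in>{i \<in> {..<m}. D \<subseteq> P i}. prod gain D)
        \<le> real m * (\<Prod>p\<in>D. gain p / real p) + 3 / sqrt (\<Prod>D)" .
  qed
  also have "\<dots> = real m * (\<Sum>D\<in>DD. \<Prod>p\<in>D. gain p / real p) + 3 * (\<Sum>D\<in>DD. 1 / sqrt (\<Prod>D))"
    by (simp add: sum.distrib sum_distrib_left del: of_nat_prod)
  finally have moment_le: "(\<Sum>i<m. \<Prod>p\<in>P i. 1 + gain p) \<le>
    real m * (\<Sum>D\<in>DD. \<Prod>p\<in>D. gain p / real p) + 3 * (\<Sum>D\<in>DD. 1 / sqrt (\<Prod>D))" .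
  have euler: "(\<Sum>D\<in>DD. \<Prod>p\<in>D. gain p / real p) \<le> 19 / 10"
  proof -
    have "0 \<le> gain p / real p" if "p \<in> U" for p
      using that prime_ge_1_nat by (auto simp: U_def intro!: gain_nonneg divide_nonneg_nonneg)
    then have "(\<Sum>D\<in>DD. \<Prod>p\<in>D. gain p / real p) \<le> (\<Sum>D\<in>Pow U. \<Prod>p\<in>D. gain p / real p)"
      using finU by (intro sum_mono2 prod_nonneg) (auto simp: DD_def)
    also have "\<dots> = (\<Prod>p\<in>U. gain p / real p + 1)"
      by (subst prod_add[OF finU]) simp
    also have "\<dots> \<le> 19 / 10"
      using euler_product_le[OF D[OF subset_refl]] by (simp add: add.commute)
    finally show ?thesis .
  qed
  have tail: "(\<Sum>D\<in>DD. 1 / sqrt (\<Prod>D)) \<le> real m / 120"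
  proof -
    \<comment> \<open>By unique factorization different \<open>D\<close> have different products, so
      the remainder is dominated by a sum over the odd numbers up to 6 m + 2.\<close>
    have inj: "inj_on Prod DD"
    proof (rule inj_onI)
      fix D E assume DE: "D \<in> DD" "E \<in> DD" "\<Prod>D = \<Prod>E"
      then have sub: "D \<subseteq> U" "E \<subseteq> U" by (auto simp: DD_def)
      have "p \<in> D \<longleftrightarrow> p \<in> E" if "p \<in> U" for p
        using prime_dvd_prod_primes_iff[of D p] prime_dvd_prod_primes_iff[of E p]
          D[OF sub(1)] D[OF sub(2)] DE(3) that by (auto simp: U_def)
      with sub show "D = E" by blast
    qed
    have "Prod ` DD \<subseteq> (\<lambda>j. 2 * j + 1) ` {..<3 * m + 1}"
    proof
      fix d assume "d \<in> Prod ` DD"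
      then obtain D' where D': "D' \<in> DD" "d = \<Prod>D'" by blast
      then have "D' \<subseteq> U" by (simp add: DD_def)
      then have "odd d" using D[of D'] D' by (auto simp: even_prod_iff)
      moreover have "d \<le> 6 * m + 2" using D' by (simp add: DD_def)
      ultimately have "d = 2 * (d div 2) + 1" "d div 2 < 3 * m + 1" by presburger+
      then show "d \<in> (\<lambda>j. 2 * j + 1) ` {..<3 * m + 1}" by blast
    qed
    then have "(\<Sum>d\<in>Prod ` DD. 1 / sqrt (real d)) \<le>
        (\<Sum>d\<in>(\<lambda>j. 2 * j + 1) ` {..<3 * m + 1}. 1 / sqrt (real d))"
      by (intro sum_mono2) auto
    also have "\<dots> = (\<Sum>j<3 * m + 1. 1 / sqrt (2 * real j + 1))"
      by (subst sum.reindex) (auto simp: inj_on_def add.commute)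
    also have "\<dots> \<le> sqrt (2 * real (3 * m + 1))" by (rule sum_inverse_sqrt_odd_le)
    also have "2 * real (3 * m + 1) = 6 * real m + 2" by simp
    also have "sqrt \<dots> \<le> real m / 120" by (rule large_sqrt_le[OF m])
    finally show ?thesis by (simp add: sum.reindex[OF inj] del: of_nat_prod)
  qed
  have "real m * (\<Sum>D\<in>DD. \<Prod>p\<in>D. gain p / real p) \<le> real m * (19 / 10)"
    using euler by (intro mult_left_mono) auto
  with moment_le tail show ?thesis by argo
qed

lemma large_range_False:
  assumes m: "100000 \<le> m"
  shows False
proof -
  let ?s = "real (card S)"
  have s: "0 < ?s" using finite_S S_ne by (simp add: card_gt_0_iff)
  have "?s * (59 / 60 * real m / ?s)\<^sup>2 = (\<Sum>i\<in>S. (59 / 60 * real m / ?s)\<^sup>2)" by simp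
  also have "\<dots> \<le> (\<Sum>i\<in>S. \<Prod>p\<in>P i. 1 + gain p)"
  proof (rule sum_mono)
    fix i assume i: "i \<in> S"
    let ?c = "\<Prod>p\<in>P i. 1 - 1 / real p"
    have p3: "3 \<le> p" if "p \<in> P i" for p using that by (rule odd_primes_ge_3)
    have c: "0 < ?c" by (intro prod_pos) (use p3 in \<open>force simp: divide_less_eq\<close>)
    have "59 / 60 * real m / ?s \<le> 1 / ?c"
      using large_density_le[OF m i] c s by (simp add: field_simps)
    then have "(59 / 60 * real m / ?s)\<^sup>2 \<le> (1 / ?c)\<^sup>2" by (intro power_mono) auto
    also have "\<dots> = (\<Prod>p\<in>P i. 1 / (1 - 1 / real p)\<^sup>2)"
      by (simp add: power_divide prod_dividef prod_power_distrib)
    also have "\<dots> = (\<Prod>p\<in>P i. 1 + gain p)"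
    proof (rule prod.cong)
      fix p assume "p \<in> P i"
      then have "2 \<le> p" using p3[of p] by linarith
      then show "1 / (1 - 1 / real p)\<^sup>2 = 1 + gain p" by (rule one_plus_gain[symmetric])
    qed auto
    finally show "(59 / 60 * real m / ?s)\<^sup>2 \<le> (\<Prod>p\<in>P i. 1 + gain p)" .
  qed
  also have "\<dots> \<le> (\<Sum>i<m. \<Prod>p\<in>P i. 1 + gain p)"
  proof (rule sum_mono2)
    fix i assume "i \<in> {..<m} - S"
    have "0 \<le> 1 + gain p" if "p \<in> P i" for p
      using gain_nonneg[of p] odd_primes_ge_3[OF that] by simp
    then show "0 \<le> (\<Prod>p\<in>P i. 1 + gain p)" by (rule prod_nonneg)
  qed (use S in auto)
  also have "\<dots> \<le> 77 / 40 * real m" by (rule large_moment_le[OF m])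
  finally have "(59 / 60 * real m) * (59 / 60 * real m) \<le> 77 / 40 * real m * ?s"
    using s by (simp add: power2_eq_square field_simps)
  then have "real m * (3481 / 3600 * real m) \<le> real m * (77 / 40 * ?s)" by (simp add: mult_ac)
  then have "3481 / 3600 * real m \<le> 77 / 40 * ?s" using m by simp
  \<comment> \<open>With \<open>card S\<close> at most (m + 1) / 2 this reads 3481/3600 m <=
    3465/3600 (m + 1), which fails from m = 217 on.\<close>
  then show False using real_card_S m by (simp add: field_simps)
qed

lemma hall_violator_False: "9 \<le> m \<Longrightarrow> False"
  using mid_range_False large_range_False by (cases "m < 100000") auto

end

section \<open>From progressions to intervals\<close>

lemma coprime_progressions:
  fixes a b m :: nat
  assumes m: "9 \<le> m" and parity: "odd (a + b)" and pos: "0 < a" "0 < b"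
    and le: "a + 2 * (m - 1) \<le> 6 * m + 2" "b + 2 * (m - 1) \<le> 6 * m + 2"
  shows "\<exists>f. inj_on f {..<m} \<and> (\<forall>i<m. f i < m \<and> coprime (a + 2 * i) (b + 2 * f i))"
proof -
  let ?N = "\<lambda>i. {j. j < m \<and> coprime (a + 2 * i) (b + 2 * j)}"
  have "\<exists>f. inj_on f {..<m} \<and> (\<forall>i\<in>{..<m}. f i \<in> ?N i)"
  proof (rule hall_marriage)
    fix S assume S: "S \<subseteq> {..<m}"
    show "card S \<le> card (\<Union>i\<in>S. ?N i)"
    proof (rule ccontr)
      assume less: "\<not> ?thesis"
      let ?M = "\<Union>i\<in>S. ?N i"
      have "?M \<subseteq> {..<m}" by auto
      then have "card ({..<m} - ?M) = m - card ?M" "card ?M \<le> m"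
        using card_mono[of "{..<m}" ?M] finite_subset[of ?M "{..<m}"]
        by (auto simp: card_Diff_subset)
      \<comment> \<open>Fewer than \<open>card S\<close> indices are neighbours of \<open>S\<close>.
        Of the others exactly \<open>m + 1 - card S\<close> are selected, as \<open>card_ST\<close>
        demands.\<close>
      then have "m + 1 - card S \<le> card ({..<m} - ?M)" using less by linarith
      then obtain T where T: "T \<subseteq> {..<m} - ?M" "card T = m + 1 - card S"
        by (rule obtain_subset_with_card_n)
      have "card S \<le> m" using card_mono[OF _ S] by simp
      then have card_ST: "card S + card T = m + 1" using T by simp
      have "card S \<noteq> 0" "card T \<noteq> 0" using less \<open>card S \<le> m\<close> T(2) by auto
      then have ne: "S \<noteq> {}" "T \<noteq> {}" by auto
      have nc: "\<not> coprime (a + 2 * i) (b + 2 * j)" if "i \<in> S" "j \<in> T" for i j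
        using that T(1) by auto
      have T': "T \<subseteq> {..<m}" using T(1) by blast
      show False
      proof (cases "2 * card S \<le> m + 1")
        case True
        interpret hall_violator a b m S T
          using S T' ne nc card_ST True parity pos le by unfold_locales auto
        show False using m by (rule hall_violator_False)
      next
        case False
        interpret hall_violator b a m T S
          using S T' ne nc card_ST False parity pos le
          by unfold_locales (auto simp: coprime_commute add.commute)
        show False using m by (rule hall_violator_False)
      qed
    qed
  qed auto
  then show ?thesis by auto
qed

text \<open>From k = 18 on, both parity classes of the interval have at least 9 members, so each can
  be matched by \<open>coprime_progressions\<close>.\<close>

lemma coprime_matching_large:
  fixes k l :: nat
  assumes k: "18 \<le> k" and l: "l < k"
  shows "\<exists>f. inj_on f {l + 1..l + k} \<and>
    (\<forall>x\<in>{l + 1..l + k}. f x \<in> {l + k + 1..l + 2 * k} \<and> coprime x (f x))"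
proof -
  define m1 m2 where "m1 = (k + 1) div 2" and "m2 = k div 2"
  \<comment> \<open>These are the two least numbers of the second interval, ordered so that
    \<open>b1\<close> differs in parity from \<open>l + 1\<close> and \<open>b2\<close> from
    \<open>l + 2\<close>. Their classes then have \<open>m1\<close> and \<open>m2\<close> members,
    as required.\<close>
  define b1 b2 where "b1 = (if odd k then l + k + 1 else l + k + 2)"
    and "b2 = (if odd k then l + k + 2 else l + k + 1)"
  have parity: "odd (l + 1 + b1)" "odd (l + 2 + b2)" "odd (b1 + b2)"
    by (auto simp: b1_def b2_def)
  have m: "9 \<le> m1" "9 \<le> m2" "k \<le> 2 * m1" "k \<le> 2 * m2 + 1" "m1 + m2 = k"
    using k by (auto simp: m1_def m2_def)
  have b: "l + k + 1 \<le> b1" "l + k + 1 \<le> b2" by (auto simp: b1_def b2_def)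
  have b_le: "b1 + 2 * (m1 - 1) \<le> l + 2 * k" "b2 + 2 * (m2 - 1) \<le> l + 2 * k"
    using k by (auto simp: b1_def b2_def m1_def m2_def elim!: oddE evenE)
  have "\<exists>f. inj_on f {..<m1} \<and> (\<forall>i<m1. f i < m1 \<and> coprime (l + 1 + 2 * i) (b1 + 2 * f i))"
    using m parity b b_le l by (intro coprime_progressions) auto
  then obtain f1 where f1: "inj_on f1 {..<m1}"
    "\<And>i. i < m1 \<Longrightarrow> f1 i < m1 \<and> coprime (l + 1 + 2 * i) (b1 + 2 * f1 i)" by blast
  have "\<exists>f. inj_on f {..<m2} \<and> (\<forall>i<m2. f i < m2 \<and> coprime (l + 2 + 2 * i) (b2 + 2 * f i))"
    using m parity b b_le l by (intro coprime_progressions) auto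
  then obtain f2 where f2: "inj_on f2 {..<m2}"
    "\<And>i. i < m2 \<Longrightarrow> f2 i < m2 \<and> coprime (l + 2 + 2 * i) (b2 + 2 * f2 i)" by blast
  define f where "f = (\<lambda>x. if even (x - (l + 1)) then b1 + 2 * f1 ((x - (l + 1)) div 2)
    else b2 + 2 * f2 ((x - (l + 1)) div 2))"
  have cases: "(\<exists>i<m1. x = l + 1 + 2 * i) \<or> (\<exists>i<m2. x = l + 2 + 2 * i)"
    if x: "x \<in> {l + 1..l + k}" for x
  proof -
    define d where "d = x - (l + 1)"
    have d: "x = l + 1 + d" "d < k" using x by (auto simp: d_def)
    show ?thesis
    proof (cases "even d")
      case True
      then obtain i where "d = 2 * i" by (elim evenE)
      then show ?thesis using d by (auto simp: m1_def)
    next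
      case False
      then obtain i where "d = 2 * i + 1" by (elim oddE)
      then show ?thesis using d by (auto simp: m2_def)
    qed
  qed
  have f_1: "f (l + 1 + 2 * i) = b1 + 2 * f1 i" for i by (simp add: f_def)
  have f_2: "f (l + 2 + 2 * i) = b2 + 2 * f2 i" for i
  proof -
    have "l + 2 + 2 * i - (l + 1) = 2 * i + 1" by simp
    then show ?thesis by (simp add: f_def)
  qed
  have "inj_on f {l + 1..l + k}"
  proof (rule inj_onI)
    fix x y assume xy: "x \<in> {l + 1..l + k}" "y \<in> {l + 1..l + k}" "f x = f y"
    have neq: "b1 + 2 * i \<noteq> b2 + 2 * j" for i j using parity(3) by presburger
    from cases[OF xy(1)] cases[OF xy(2)] show "x = y"
    proof (elim disjE exE conjE)
      fix i j assume "i < m1" "x = l + 1 + 2 * i" "j < m1" "y = l + 1 + 2 * j"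
      then show ?thesis using xy(3) f1(1) by (simp only: f_1) (auto dest: inj_onD)
    next
      fix i j assume "i < m2" "x = l + 2 + 2 * i" "j < m2" "y = l + 2 + 2 * j"
      then show ?thesis using xy(3) f2(1) by (simp only: f_2) (auto dest: inj_onD)
    next
      fix i j assume "x = l + 1 + 2 * i" "y = l + 2 + 2 * j"
      then show ?thesis using xy(3) neq by (simp only: f_1 f_2)
    next
      fix i j assume "x = l + 2 + 2 * i" "y = l + 1 + 2 * j"
      then show ?thesis using xy(3) neq by (simp only: f_1 f_2) metis
    qed
  qed
  moreover have "f x \<in> {l + k + 1..l + 2 * k} \<and> coprime x (f x)" if x: "x \<in> {l + 1..l + k}" for x
    using cases[OF x]
  proof (elim disjE exE conjE)
    fix i assume i: "i < m1" "x = l + 1 + 2 * i"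
    have "b1 + 2 * f1 i \<le> l + 2 * k" using f1(2)[OF i(1)] b_le by linarith
    then show ?thesis unfolding i(2) f_1 using f1(2)[OF i(1)] b by auto
  next
    fix i assume i: "i < m2" "x = l + 2 + 2 * i"
    have "b2 + 2 * f2 i \<le> l + 2 * k" using f2(2)[OF i(1)] b_le by linarith
    then show ?thesis unfolding i(2) f_2 using f2(2)[OF i(1)] b by auto
  qed
  ultimately show ?thesis by blast
qed

lemma coprime_matching_small:
  fixes k l :: nat
  assumes k: "4 \<le> k" "k < 18" and l: "l < k"
  shows "\<exists>f. inj_on f {l + 1..l + k} \<and>
    (\<forall>x\<in>{l + 1..l + k}. f x \<in> {l + k + 1..l + 2 * k} \<and> coprime x (f x))"
proof -
  let ?xs = "filter even [l+1..<l+k+1] @ filter odd [l+1..<l+k+1]"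
  let ?ys = "filter odd [l+k+1..<l+2*k+1] @ filter even [l+k+1..<l+2*k+1]"
  have "matchable ?xs ?ys"
  proof -
    have "k \<in> set [4..<18]" "l \<in> set [0..<k]" unfolding set_upt using k l by simp_all
    then show ?thesis using matchable_small by blast
  qed
  moreover have "distinct ?xs" "distinct ?ys" by auto
  ultimately have "\<exists>f. inj_on f (set ?xs) \<and> (\<forall>x\<in>set ?xs. f x \<in> set ?ys \<and> coprime x (f x))"
    by (rule matchable_imp_injection)
  moreover have "set ?xs = {l + 1..l + k}" "set ?ys = {l + k + 1..l + 2 * k}" by auto
  ultimately show ?thesis by (simp only:)
qed

theorem theorem1p6:
  fixes l k :: int
  assumes "0 \<le> l" and "l < k" and "k \<ge> 4"
  shows "\<exists>g. coprime_mapping g {l+1..l+k} {l+k+1..l+2*k}"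
proof -
  obtain l' k' where nat: "l = int l'" "k = int k'"
    using assms by (metis nonneg_int_cases order_less_imp_le order_trans)
  have "\<exists>f. inj_on f {l' + 1..l' + k'} \<and>
      (\<forall>x\<in>{l' + 1..l' + k'}. f x \<in> {l' + k' + 1..l' + 2 * k'} \<and> coprime x (f x))"
    using assms coprime_matching_small[of k' l'] coprime_matching_large[of k' l']
    unfolding nat by (cases "k' < 18") auto
  then obtain f where f: "inj_on f {l' + 1..l' + k'}" "\<And>x. x \<in> {l' + 1..l' + k'} \<Longrightarrow>
      f x \<in> {l' + k' + 1..l' + 2 * k'} \<and> coprime x (f x)" by blast
  let ?A = "{l+1..l+k}" and ?B = "{l+k+1..l+2*k}"
  define g where "g = (\<lambda>x. int (f (nat x)))"
  have A: "nat x \<in> {l' + 1..l' + k'} \<and> x = int (nat x)" if "x \<in> ?A" for x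
    using that unfolding nat by auto
  have "inj_on g ?A"
  proof (rule inj_onI)
    fix x y assume xy: "x \<in> ?A" "y \<in> ?A" "g x = g y"
    then have "nat x = nat y" using A f(1) by (auto simp: g_def dest: inj_onD)
    then show "x = y" using A[OF xy(1)] A[OF xy(2)] by simp
  qed
  moreover have "g ` ?A = ?B"
  proof (rule card_subset_eq)
    show "g ` ?A \<subseteq> ?B"
    proof
      fix y assume "y \<in> g ` ?A"
      then obtain x where x: "x \<in> ?A" "y = g x" by blast
      then show "y \<in> ?B" using f(2)[of "nat x"] A[OF x(1)] unfolding g_def nat by auto
    qed
    show "card (g ` ?A) = card ?B" using \<open>inj_on g ?A\<close> by (simp add: card_image)
  qed auto
  moreover have "coprime x (g x)" if "x \<in> ?A" for x
  proof -
    have "coprime (int (nat x)) (g x)"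
      unfolding g_def coprime_int_iff using f(2)[of "nat x"] A[OF that] by blast
    then show ?thesis using A[OF that] by simp
  qed
  ultimately show ?thesis unfolding coprime_mapping_def bij_betw_def by blast
qed

end
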